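(* Let $(X,T)$ be an expansive minimal Cantor system with a nested sequence of clopen Kakutani-Rohlin partitions $(\mathcal T_n)_{n\in\mathbb N}$, where $\mathcal T_n$ has $d_n$ towers, of heights $(h_n(k))_{1\le k\le d_n}$. Suppose that $$\sup_{n\in\mathbb N}d_n<+\infty\quad\text{and}\quad\liminf_{n\to+\infty}\ \sup_{1\le k,k'\le d_n}\frac{h_n(k)}{h_n(k')}<+\infty.$$ Then $(X,T)$ is topologically conjugate to a minimal subshift $(Y,S)$ with non-superlinear complexity, i.e. $\liminf_{n\to+\infty}p_Y(n)/n<+\infty$.
   Context: A minimal Cantor system $(X,T)$ is a homeomorphism $T$ of a Cantor set $X$ all of whose orbits are dense. A clopen Kakutani-Rohlin partition of $X$ is a partition $\mathcal T=\{T^{-j}B(k):1\le k\le d,\ 0\le j<h(k)\}$ of $X$, where $B(1),\dots,B(d)$ are clopen, $h(k)\geq 1$ are integers and $\bigcup_k T^{-h(k)}B(k)=\bigcup_k B(k)$; its base is $B(\mathcal T)=\bigcup_kB(k)$; $\{T^{-j}B(k):0\le j<h(k)\}$ is its $k$-th tower and $h(k)$ the height of that tower. A sequence $(\mathcal T_n)_{n\ge0}$ of such partitions, with $\mathcal T_0=\{X\}$, is nested if for all $n\ge0$: (KR1) $B(\mathcal T_{n+1})\subseteq B(\mathcal T_n)$; (KR2) every atom of $\mathcal T_{n+1}$ is contained in an atom of $\mathcal T_n$; (KR3) $\bigcap_nB(\mathcal T_n)$ consists of a unique point; (KR4) the sequence of partitions spans the topology of $X$. $S$ is the shift map and $p_Y(n)$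 is the number of words of length $n$ occurring in elements of the subshift $Y$. *)

theory Defs
  imports "HOL-Analysis.Analysis" "HOL-Library.Disjoint_Sets" "HOL-Library.Extended_Nat"
begin

definition is_cantor_set :: "'a::topological_space set \<Rightarrow> bool" where
  "is_cantor_set X \<longleftrightarrow> X homeomorphic (UNIV :: (nat \<Rightarrow> bool) set)"

(* Integer powers of a bijection T of X; T is arbitrary off X, hence inv_into X. *)
definition int_iterate :: "'a set \<Rightarrow> ('a \<Rightarrow> 'a) \<Rightarrow> int \<Rightarrow> 'a \<Rightarrow> 'a" where
  "int_iterate X T n = (if 0 \<le> n then T ^^ nat n else inv_into X T ^^ nat (- n))"

definition orbit_of :: "'a set \<Rightarrow> ('a \<Rightarrow> 'a) \<Rightarrow> 'a \<Rightarrow> 'a set" where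
  "orbit_of X T x = range (\<lambda>n. int_iterate X T n x)"

definition all_orbits_dense :: "'a::topological_space set \<Rightarrow> ('a \<Rightarrow> 'a) \<Rightarrow> bool" where
  "all_orbits_dense X T \<longleftrightarrow> (\<forall>x\<in>X. X \<subseteq> closure (orbit_of X T x))"

definition minimal_cantor_system :: "'a::topological_space set \<Rightarrow> ('a \<Rightarrow> 'a) \<Rightarrow> bool" where
  "minimal_cantor_system X T \<longleftrightarrow>
     is_cantor_set X \<and> (\<exists>T'. homeomorphism X X T T') \<and> all_orbits_dense X T"

definition expansive :: "'a::metric_space set \<Rightarrow> ('a \<Rightarrow> 'a) \<Rightarrow> bool" where
  "expansive X T \<longleftrightarrow>
     (\<exists>\<delta>>0. \<forall>x\<in>X. \<forall>y\<in>X. x \<noteq> y \<longrightarrow>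
        (\<exists>n. dist (int_iterate X T n x) (int_iterate X T n y) > \<delta>))"

definition topologically_conjugate ::
  "'a::topological_space set \<Rightarrow> ('a \<Rightarrow> 'a) \<Rightarrow> 'b::topological_space set \<Rightarrow> ('b \<Rightarrow> 'b) \<Rightarrow> bool" where
  "topologically_conjugate X T Y S \<longleftrightarrow>
     (\<exists>f g. homeomorphism X Y f g \<and> (\<forall>x\<in>X. f (T x) = S (f x)))"

text \<open>
  A Kakutani-Rohlin partition is given by the number \<open>d\<close> of towers, the bases \<open>B k\<close> and
  the heights \<open>h k\<close> for \<open>1 \<le> k \<le> d\<close>; the values of \<open>B\<close> and \<open>h\<close> at other indices are irrelevant.
\<close>

(* T^(-j) B(k), a preimage under a self-map of X *)
definition kr_atom :: "'a set \<Rightarrow> ('a \<Rightarrow> 'a) \<Rightarrow> (nat \<Rightarrow> 'a set) \<Rightarrow> nat \<Rightarrow> nat \<Rightarrow> 'a set" where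
  "kr_atom X T B k j = X \<inter> (T ^^ j) -` B k"

definition kr_indices :: "nat \<Rightarrow> (nat \<Rightarrow> nat) \<Rightarrow> (nat \<times> nat) set" where
  "kr_indices d h = (SIGMA k:{1..d}. {..<h k})"

definition kr_atoms ::
  "'a set \<Rightarrow> ('a \<Rightarrow> 'a) \<Rightarrow> nat \<Rightarrow> (nat \<Rightarrow> 'a set) \<Rightarrow> (nat \<Rightarrow> nat) \<Rightarrow> 'a set set" where
  "kr_atoms X T d B h = (\<lambda>(k, j). kr_atom X T B k j) ` kr_indices d h"

definition kr_base :: "nat \<Rightarrow> (nat \<Rightarrow> 'a set) \<Rightarrow> 'a set" where
  "kr_base d B = (\<Union>k\<in>{1..d}. B k)"

(* Injectivity makes different pairs (k, j) denote different, hence disjoint, atoms;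
   a partition as a mere set of sets would not see repetitions. *)
definition clopen_kr_partition ::
  "'a::topological_space set \<Rightarrow> ('a \<Rightarrow> 'a) \<Rightarrow> nat \<Rightarrow> (nat \<Rightarrow> 'a set) \<Rightarrow> (nat \<Rightarrow> nat) \<Rightarrow> bool" where
  "clopen_kr_partition X T d B h \<longleftrightarrow>
     (\<forall>k\<in>{1..d}. openin (top_of_set X) (B k) \<and> closedin (top_of_set X) (B k) \<and> 1 \<le> h k) \<and>
     partition_on X (kr_atoms X T d B h) \<and>
     inj_on (\<lambda>(k, j). kr_atom X T B k j) (kr_indices d h) \<and>
     (\<Union>k\<in>{1..d}. kr_atom X T B k (h k)) = kr_base d B"

definition nested_kr_partitions ::
  "'a::topological_space set \<Rightarrow> ('a \<Rightarrow> 'a) \<Rightarrow> (nat \<Rightarrow> nat) \<Rightarrow> (nat \<Rightarrow> nat \<Rightarrow> 'a set) \<Rightarrow>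
    (nat \<Rightarrow> nat \<Rightarrow> nat) \<Rightarrow> bool" where
  "nested_kr_partitions X T d B h \<longleftrightarrow>
     (\<forall>n. clopen_kr_partition X T (d n) (B n) (h n)) \<and>
     kr_atoms X T (d 0) (B 0) (h 0) = {X} \<and>
     (\<forall>n. kr_base (d (Suc n)) (B (Suc n)) \<subseteq> kr_base (d n) (B n)) \<and>
     (\<forall>n. \<forall>P\<in>kr_atoms X T (d (Suc n)) (B (Suc n)) (h (Suc n)).
        \<exists>Q\<in>kr_atoms X T (d n) (B n) (h n). P \<subseteq> Q) \<and>
     (\<exists>x. (\<Inter>n. kr_base (d n) (B n)) = {x}) \<and>
     top_of_set X = topology_generated_by (\<Union>n. kr_atoms X T (d n) (B n) (h n))"

text \<open>
  Two-sided subshifts. Letters are natural numbers, so that the finite alphabet may be arbitrary;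
  \<^typ>\<open>nat\<close> is discrete and \<^typ>\<open>int \<Rightarrow> nat\<close> carries the product topology.
\<close>

definition shift_map :: "(int \<Rightarrow> 'b) \<Rightarrow> (int \<Rightarrow> 'b)" where
  "shift_map y = (\<lambda>i. y (i + 1))"

definition subshift :: "(int \<Rightarrow> nat) set \<Rightarrow> bool" where
  "subshift Y \<longleftrightarrow>
     (\<exists>A. finite A \<and> Y \<subseteq> (UNIV \<rightarrow> A)) \<and> closed Y \<and> shift_map ` Y = Y"

definition minimal_subshift :: "(int \<Rightarrow> nat) set \<Rightarrow> bool" where
  "minimal_subshift Y \<longleftrightarrow> subshift Y \<and> Y \<noteq> {} \<and> all_orbits_dense Y shift_map"

definition words_of_length :: "(int \<Rightarrow> 'b) set \<Rightarrow> nat \<Rightarrow> 'b list set" where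
  "words_of_length Y n = {map (\<lambda>j. y (i + int j)) [0..<n] | y i. y \<in> Y}"

definition complexity :: "(int \<Rightarrow> 'b) set \<Rightarrow> nat \<Rightarrow> nat" where
  "complexity Y n = card (words_of_length Y n)"

definition non_superlinear_complexity :: "(int \<Rightarrow> 'b) set \<Rightarrow> bool" where
  "non_superlinear_complexity Y \<longleftrightarrow>
     liminf (\<lambda>n. ereal (real (complexity Y n) / real n)) < \<infinity>"

end

theory Submission imports Defs
begin

text \<open>
  By compactness the atoms of some \<open>\<T>\<^sub>m\<close> are smaller than the expansivity constant, so coding orbits by
  \<open>\<T>\<^sub>m\<close> is a conjugacy onto a subshift \<open>Y\<close>. For \<open>n \<ge> m\<close>, a word of \<open>Y\<close> whose length is the minimal
  height of \<open>\<T>\<^sub>n\<close> meets at most two consecutive towers, so there are at most \<open>d\<^sub>n \<Sum>\<^sub>k h\<^sub>n(k)\<close> of them,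
  which is linear in the length whenever the ratios of the heights of \<open>\<T>\<^sub>n\<close> are bounded. The minimal
  heights tend to infinity: a bounded return time to all the bases would, in the limit, make the
  point in their intersection periodic.
\<close>

section \<open>Compactness and infinitude of Cantor sets\<close>

lemma is_cantor_set_compact:
  assumes "is_cantor_set X"
  shows "compact X"
proof -
  have "compact_space (euclidean :: bool topology)"
    by (simp add: compact_space_def finite_imp_compact)
  then have "compact_space (product_topology (\<lambda>_::nat. euclidean :: bool topology) UNIV)"
    by (simp add: compact_space_product_topology)
  then have "compact (UNIV :: (nat \<Rightarrow> bool) set)"
    by (simp add: euclidean_product_topology compact_space_def)
  then show ?thesis
    using assms homeomorphic_compactness unfolding is_cantor_set_def by blast
qed

lemma is_cantor_set_infinite:
  assumes "is_cantor_set X"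
  shows "infinite X"
proof -
  have "infinite (UNIV :: (nat \<Rightarrow> bool) set)"
    using finite_fun_UNIVD1[where ?'a = nat and ?'b = bool] by (auto simp: UNIV_bool)
  then show ?thesis
    using assms unfolding is_cantor_set_def
    by (metis homeomorphic_def homeomorphism_def finite_imageI)
qed

section \<open>Integer iterates of a bijection\<close>

lemma int_iterate_0 [simp]: "int_iterate X T 0 x = x"
  by (simp add: int_iterate_def)

text \<open>Gives one recurrence across the sign change in the definition: for negative
  \<open>i\<close>, applying \<open>T\<close> cancels one factor \<open>inv_into X T\<close>, which
  requires staying inside \<open>X\<close>.\<close>

lemma int_iterate_Suc:
  assumes "bij_betw T X X" and "x \<in> X"
  shows "int_iterate X T i x \<in> X \<and> int_iterate X T (i + 1) x = T (int_iterate X T i x)"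
proof -
  have fw: "(T ^^ n) x \<in> X" for n
    using assms by (induction n) (auto simp: bij_betw_apply)
  have bw: "(inv_into X T ^^ n) x \<in> X" for n
    using assms by (induction n) (auto simp: bij_betw_apply[OF bij_betw_inv_into])
  show ?thesis
  proof (cases "0 \<le> i")
    case True
    then show ?thesis by (simp add: int_iterate_def fw nat_add_distrib)
  next
    case False
    then obtain m where i: "i = - int (Suc m)"
      by (metis int_cases of_nat_0_le_iff)
    have "int_iterate X T (i + 1) x = (inv_into X T ^^ m) x"
      by (cases "m = 0") (simp_all add: i int_iterate_def)
    also have "\<dots> = T (inv_into X T ((inv_into X T ^^ m) x))"
      using bw[of m] assms by (simp add: bij_betw_inv_into_right)
    also have "\<dots> = T (int_iterate X T i x)"
      by (simp add: i int_iterate_def nat_add_distrib)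
    finally show ?thesis
      using bw by (simp add: i int_iterate_def)
  qed
qed

lemmas int_iterate_in = int_iterate_Suc[THEN conjunct1]
lemmas int_iterate_add_1 = int_iterate_Suc[THEN conjunct2]

lemma int_iterate_diff_1:
  assumes "bij_betw T X X" and "x \<in> X"
  shows "int_iterate X T (i - 1) x = inv_into X T (int_iterate X T i x)"
  using int_iterate_Suc[OF assms, of "i - 1"] assms(1) 
  by (auto simp: bij_betw_inv_into_left)

lemma int_iterate_add_nat:
  assumes "bij_betw T X X" and "x \<in> X"
  shows "int_iterate X T (i + int n) x = (T ^^ n) (int_iterate X T i x)"
proof (induction n)
  case (Suc n)
  then show ?case
    using int_iterate_add_1[OF assms, of "i + int n"] by (simp add: ac_simps)
qed simp

text \<open>Backwards in time, the two sides have the same image under \<open>S\<close>, so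
  injectivity of \<open>S\<close> on \<open>Y\<close> identifies them.\<close>

lemma int_iterate_semiconjugacy:
  assumes T: "bij_betw T X X" and S: "bij_betw S Y Y" and f: "f ` X \<subseteq> Y"
    and comm: "\<And>x. x \<in> X \<Longrightarrow> f (T x) = S (f x)" and x: "x \<in> X"
  shows "f (int_iterate X T i x) = int_iterate Y S i (f x)"
proof (induction i rule: int_induct[where k = 0])
  case (step1 i)
  then show ?case
    using int_iterate_Suc[OF T x] int_iterate_Suc[OF S, of "f x"] comm f x by auto
next
  case (step2 i)
  have "S (f (int_iterate X T (i - 1) x)) = f (int_iterate X T i x)"
    using int_iterate_Suc[OF T x, of "i - 1"] comm by simp
  also have "\<dots> = S (int_iterate Y S (i - 1) (f x))"
    using int_iterate_Suc[OF S, of "f x" "i - 1"] f x step2 by auto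
  finally show ?case
    using S f x int_iterate_in[OF T x] int_iterate_in[OF S, of "f x"]
    by (auto simp: bij_betw_def dest!: inj_onD)
qed simp

text \<open>\<open>T\<close> commutes with itself, hence is a semiconjugacy from \<open>T\<close> to
  \<open>T\<close>.\<close>

lemma int_iterate_image:
  assumes "bij_betw T X X" and "x \<in> X"
  shows "int_iterate X T i (T x) = int_iterate X T (i + 1) x"
  using int_iterate_semiconjugacy[of T X T X T x i] int_iterate_add_1[of T X x i] assms
  by (auto simp: bij_betw_def)

lemma homeomorphism_bij_betw:
  assumes "homeomorphism X Y f g"
  shows "bij_betw f X Y"
  using assms by (auto simp: homeomorphism_def bij_betw_def intro: inj_on_inverseI)

lemma continuous_on_int_iterate:
  assumes hom: "homeomorphism X X T T'"
  shows "continuous_on X (int_iterate X T i)"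
proof -
  note bij = homeomorphism_bij_betw[OF hom]
  have "inv_into X T x = T' x" if "x \<in> X" for x
    using hom that by (metis bij bij_betw_inv_into_left homeomorphism_def imageI)
  then have inv: "continuous_on X (inv_into X T)"
    using hom by (metis continuous_on_cong homeomorphism_def)
  have sub: "int_iterate X T i ` X \<subseteq> X" for i
    using int_iterate_in[OF bij] by auto
  show ?thesis
  proof (induction i rule: int_induct[where k = 0])
    case base
    show ?case by (simp add: continuous_on_id)
  next
    case (step1 i)
    have "continuous_on X (\<lambda>x. T (int_iterate X T i x))"
      using continuous_on_compose2[OF _ step1(2) sub] homeomorphism_cont1[OF hom] by blast
    then show ?case
      by (simp add: int_iterate_add_1[OF bij] cong: continuous_on_cong)
  next
    case (step2 i)
    have "continuous_on X (\<lambda>x. inv_into X T (int_iterate X T i x))"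
      using continuous_on_compose2[OF inv step2(2) sub] .
    then show ?case
      by (simp add: int_iterate_diff_1[OF bij] cong: continuous_on_cong)
  qed
qed

section \<open>Dense orbits: factors and aperiodicity\<close>

lemma continuous_on_image_closure_Int:
  assumes f: "continuous_on X f" and A: "A \<subseteq> X"
  shows "f ` (X \<inter> closure A) \<subseteq> closure (f ` A)"
proof -
  have "closedin (top_of_set X) (X \<inter> f -` closure (f ` A))"
    using continuous_closedin_preimage[OF f closed_closure] .
  then obtain C where C: "closed C" "X \<inter> f -` closure (f ` A) = X \<inter> C"
    by (auto simp: closedin_closed)
  have "A \<subseteq> X \<inter> f -` closure (f ` A)"
    using A closure_subset[of "f ` A"] by auto
  then have "closure A \<subseteq> C"
    using C closure_minimal[of A C] by auto
  then show ?thesis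
    using C(2) by blast
qed

text \<open>A factor map sends orbits onto orbits and, by continuity, limit points in
  \<open>X\<close> into the closure of the image.\<close>

lemma all_orbits_dense_image:
  assumes T: "bij_betw T X X" and S: "bij_betw S Y Y"
    and f: "continuous_on X f" "f ` X = Y" and comm: "\<And>x. x \<in> X \<Longrightarrow> f (T x) = S (f x)"
    and dense: "all_orbits_dense X T"
  shows "all_orbits_dense Y S"
  unfolding all_orbits_dense_def
proof
  fix y assume "y \<in> Y"
  then obtain x where x: "x \<in> X" "y = f x" using f by auto
  have sub: "orbit_of X T x \<subseteq> X"
    using int_iterate_in[OF T x(1)] by (auto simp: orbit_of_def)
  have orb: "f ` orbit_of X T x = orbit_of Y S y"
    unfolding orbit_of_def x(2) image_image
    using int_iterate_semiconjugacy[OF T S _ _ x(1), of f] comm f by auto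
  have "X \<subseteq> closure (orbit_of X T x)"
    using dense x by (auto simp: all_orbits_dense_def)
  then have "f ` X \<subseteq> closure (f ` orbit_of X T x)"
    using continuous_on_image_closure_Int[OF f(1) sub] by blast
  then show "Y \<subseteq> closure (orbit_of Y S y)"
    using orb f by simp
qed

text \<open>A periodic point has a finite orbit; finite sets are closed in a T1 space, so a dense
  one would exhaust the infinite set \<open>X\<close>.\<close>

lemma minimal_aperiodic:
  fixes X :: "'a::t1_space set"
  assumes T: "bij_betw T X X" and dense: "all_orbits_dense X T" and inf: "infinite X"
    and x: "x \<in> X" and j: "0 < j"
  shows "(T ^^ j) x \<noteq> x"
proof
  assume per: "(T ^^ j) x = x"
  define F where "F = (\<lambda>i. (T ^^ i) x) ` {..<j}"
  have "orbit_of X T x \<subseteq> F"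
  proof -
    have in_X: "(T ^^ i) x \<in> X" for i
      using int_iterate_in[OF T x, of "int i"] by (simp add: int_iterate_def)
    have "int_iterate X T i x \<in> F" for i
    proof (induction i rule: int_induct[where k = 0])
      case base
      show ?case using j by (auto simp: F_def intro!: image_eqI[of _ _ 0])
    next
      case (step1 i)
      then obtain l where l: "l < j" "int_iterate X T i x = (T ^^ l) x"
        by (auto simp: F_def)
      have "int_iterate X T (i + 1) x = (T ^^ Suc l) x"
        using l int_iterate_add_1[OF T x] by simp
      then show ?case
        using l per j by (cases "Suc l = j") (auto simp: F_def intro: image_eqI[of _ _ 0] image_eqI[of _ _ "Suc l"])
    next
      case (step2 i)
      then obtain l where l: "l < j" "int_iterate X T i x = (T ^^ l) x"
        by (auto simp: F_def)
      \<comment> \<open>The predecessor of \<open>l\<close> modulo the period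
        \<open>j\<close>.\<close>
      define m where "m = (if l = 0 then j - 1 else l - 1)"
      have "(T ^^ Suc m) x = (T ^^ l) x" and "m < j"
        using l j per by (cases l; cases j; simp add: m_def)+
      then have "int_iterate X T (i - 1) x = (T ^^ m) x"
        using l int_iterate_diff_1[OF T x, of i] bij_betw_inv_into_left[OF T in_X[of m]]
        by simp
      with \<open>m < j\<close> show ?case by (auto simp: F_def)
    qed
    then show ?thesis by (auto simp: orbit_of_def)
  qed
  moreover have "finite F" by (simp add: F_def)
  moreover have "X \<subseteq> closure (orbit_of X T x)"
    using dense x by (auto simp: all_orbits_dense_def)
  ultimately have "X \<subseteq> F"
    using closure_minimal[OF _ finite_imp_closed, of "orbit_of X T x" F] by auto
  with \<open>finite F\<close> inf show False
    using finite_subset by blast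
qed

section \<open>Symbolic coding by itineraries\<close>

definition itinerary :: "'a set \<Rightarrow> ('a \<Rightarrow> 'a) \<Rightarrow> ('a \<Rightarrow> 'b) \<Rightarrow> 'a \<Rightarrow> int \<Rightarrow> 'b" where
  "itinerary X T c x = (\<lambda>i. c (int_iterate X T i x))"

lemma shift_map_itinerary:
  assumes "bij_betw T X X" and "x \<in> X"
  shows "shift_map (itinerary X T c x) = itinerary X T c (T x)"
  using int_iterate_image[OF assms] by (simp add: shift_map_def itinerary_def)

text \<open>Reading the itinerary of \<open>x\<close> from position \<open>i\<close> on is reading
  that of the \<open>i\<close>-th iterate from position 0 on, so forward orbit segments produce all
  words.\<close>

lemma words_of_length_itinerary:
  assumes T: "bij_betw T X X"
  shows "words_of_length (itinerary X T c ` X) n \<subseteq> (\<lambda>z. map (\<lambda>j. c ((T ^^ j) z)) [0..<n]) ` X"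
proof
  fix w assume "w \<in> words_of_length (itinerary X T c ` X) n"
  then obtain x i where x: "x \<in> X" and w: "w = map (\<lambda>j. itinerary X T c x (i + int j)) [0..<n]"
    by (auto simp: words_of_length_def)
  then have "w = map (\<lambda>j. c ((T ^^ j) (int_iterate X T i x))) [0..<n]"
    using int_iterate_add_nat[OF T x] by (simp add: itinerary_def)
  then show "w \<in> (\<lambda>z. map (\<lambda>j. c ((T ^^ j) z)) [0..<n]) ` X"
    using int_iterate_in[OF T x] by blast
qed

lemma inj_shift_map: "inj shift_map"
proof (rule injI)
  fix x y :: "int \<Rightarrow> 'a"
  assume eq: "shift_map x = shift_map y"
  show "x = y"
  proof
    fix i
    show "x i = y i"
      using fun_cong[OF eq, of "i - 1"] by (simp add: shift_map_def)
  qed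
qed

text \<open>A continuous injection of a compact space into a Hausdorff space is a closed embedding.
  This is applied after composing with the injection \<open>e\<close> into real-valued functions,
  and the conclusions are pulled back along \<open>e\<close>.\<close>

lemma homeomorphism_compact_fun_nat:
  fixes f :: "'a::topological_space \<Rightarrow> 'i::countable \<Rightarrow> nat"
  assumes X: "compact X" and f: "continuous_on X f" and inj: "inj_on f X"
  shows "closed (f ` X)" and "\<exists>g. homeomorphism X (f ` X) f g"
proof -
  \<comment> \<open>The library proves function spaces Hausdorff only for metric ranges, which \<^typ>\<open>nat\<close> is not.\<close>
  define e :: "('i \<Rightarrow> nat) \<Rightarrow> 'i \<Rightarrow> real" where "e y = (\<lambda>i. real (y i))" for y
  have e_cont: "continuous_on UNIV e"
    unfolding e_def
  proof (rule continuous_on_coordinatewise_then_product)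
    fix i :: 'i
    show "continuous_on UNIV (\<lambda>y :: 'i \<Rightarrow> nat. real (y i))"
      by (intro continuous_on_of_nat continuous_on_product_coordinates)
  qed
  have e_inj: "inj e"
    by (auto simp: inj_def e_def fun_eq_iff)
  have ef_cont: "continuous_on X (\<lambda>x. e (f x))"
    using continuous_on_compose2[OF e_cont f] by simp
  have "closed ((\<lambda>x. e (f x)) ` X)"
    using compact_imp_closed[OF compact_continuous_image[OF ef_cont X]] .
  then have "closed (e -` ((\<lambda>x. e (f x)) ` X))"
    using e_cont continuous_on_closed_vimage[OF closed_UNIV, of e] by simp
  moreover have "e -` ((\<lambda>x. e (f x)) ` X) = f ` X"
    using e_inj by (auto simp: inj_def)
  ultimately show "closed (f ` X)" by simp
  have "inj_on (\<lambda>x. e (f x)) X"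
    using inj e_inj by (auto simp: inj_on_def)
  then obtain g where g: "homeomorphism X ((\<lambda>x. e (f x)) ` X) (\<lambda>x. e (f x)) g"
    using homeomorphism_compact[OF X ef_cont refl] by blast
  have "continuous_on (f ` X) (\<lambda>y. g (e y))"
    by (rule continuous_on_compose2[OF homeomorphism_cont2[OF g]])
       (auto intro: continuous_on_subset[OF e_cont])
  then have "homeomorphism X (f ` X) f (\<lambda>y. g (e y))"
    using f homeomorphism_apply1[OF g] by (auto simp: homeomorphism_def image_image)
  then show "\<exists>g. homeomorphism X (f ` X) f g" by blast
qed

text \<open>Separation makes the coding injective, so compactness makes it a homeomorphism onto a
  closed set; it intertwines \<open>T\<close> with the shift and thus carries minimality
  over.\<close>

lemma itinerary_conjugacy:
  fixes X :: "'a::metric_space set" and c :: "'a \<Rightarrow> nat"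
  assumes X: "compact X" "X \<noteq> {}" and hom: "homeomorphism X X T T'"
    and dense: "all_orbits_dense X T"
    and c: "continuous_on X c" "finite (c ` X)"
    and sep: "\<And>x y. x \<in> X \<Longrightarrow> y \<in> X \<Longrightarrow> x \<noteq> y \<Longrightarrow>
      \<exists>i. c (int_iterate X T i x) \<noteq> c (int_iterate X T i y)"
  shows "minimal_subshift (itinerary X T c ` X)"
    and "topologically_conjugate X T (itinerary X T c ` X) shift_map"
proof -
  let ?f = "itinerary X T c"
  note bij = homeomorphism_bij_betw[OF hom]
  note in_X = int_iterate_in[OF bij]
  have cont: "continuous_on X ?f"
    unfolding itinerary_def
  proof (rule continuous_on_coordinatewise_then_product)
    fix i
    have "int_iterate X T i ` X \<subseteq> X" using in_X by blast
    then show "continuous_on X (\<lambda>x. c (int_iterate X T i x))"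
      using continuous_on_compose2[OF c(1) continuous_on_int_iterate[OF hom]] by blast
  qed
  have inj: "inj_on ?f X"
    using sep by (auto simp: inj_on_def itinerary_def dest: fun_cong)
  have shift: "shift_map (?f x) = ?f (T x)" if "x \<in> X" for x
    using shift_map_itinerary[OF bij that] .
  have "shift_map ` ?f ` X = ?f ` T ` X"
    using shift by (auto simp: image_image)
  also have "T ` X = X"
    using bij by (simp add: bij_betw_def)
  finally have img: "shift_map ` ?f ` X = ?f ` X" .
  have "closed (?f ` X)"
    using homeomorphism_compact_fun_nat(1)[OF X(1) cont inj] .
  moreover have "?f ` X \<subseteq> UNIV \<rightarrow> c ` X"
    using in_X by (auto simp: itinerary_def)
  ultimately have "subshift (?f ` X)"
    unfolding subshift_def using img c(2) by blast
  moreover have "bij_betw shift_map (?f ` X) (?f ` X)"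
    using img inj_shift_map by (auto simp: bij_betw_def intro: inj_on_subset)
  then have "all_orbits_dense (?f ` X) shift_map"
    using all_orbits_dense_image[OF bij _ cont refl _ dense] shift by metis
  ultimately show "minimal_subshift (?f ` X)"
    using X(2) by (simp add: minimal_subshift_def)
  show "topologically_conjugate X T (?f ` X) shift_map"
    using homeomorphism_compact_fun_nat(2)[OF X(1) cont inj] shift
    unfolding topologically_conjugate_def by metis
qed

section \<open>A single Kakutani-Rohlin partition and its words\<close>

lemma kr_partitionD:
  assumes "clopen_kr_partition X T d B h"
  shows "\<Union> (kr_atoms X T d B h) = X"
    and "\<And>P Q z. P \<in> kr_atoms X T d B h \<Longrightarrow> Q \<in> kr_atoms X T d B h \<Longrightarrow> z \<in> P \<Longrightarrow> z \<in> Q \<Longrightarrow> P = Q"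
    and "{} \<notin> kr_atoms X T d B h"
proof -
  have part: "partition_on X (kr_atoms X T d B h)"
    using assms by (simp add: clopen_kr_partition_def)
  show "\<Union> (kr_atoms X T d B h) = X" "{} \<notin> kr_atoms X T d B h"
    using partition_onD1[OF part] partition_onD3[OF part] by simp_all
  show "P = Q" if "P \<in> kr_atoms X T d B h" "Q \<in> kr_atoms X T d B h" "z \<in> P" "z \<in> Q" for P Q z
    using disjointD[OF partition_onD2[OF part] that(1,2)] that(3,4) by blast
qed

lemma finite_kr_indices: "finite (kr_indices d h)"
  by (simp add: kr_indices_def)

lemma finite_kr_atoms: "finite (kr_atoms X T d B h)"
  by (simp add: kr_atoms_def finite_kr_indices)

lemma kr_atom_in_atoms: "k \<in> {1..d} \<Longrightarrow> j < h k \<Longrightarrow> kr_atom X T B k j \<in> kr_atoms X T d B h"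
  unfolding kr_atoms_def kr_indices_def by (rule image_eqI[of _ _ "(k, j)"]) simp_all

lemma openin_kr_atom:
  assumes "clopen_kr_partition X T d B h" and T: "continuous_on X T" "T ` X \<subseteq> X"
    and "P \<in> kr_atoms X T d B h"
  shows "openin (top_of_set X) P"
proof -
  obtain k j where k: "k \<in> {1..d}" and P: "P = kr_atom X T B k j"
    using assms(4) by (auto simp: kr_atoms_def kr_indices_def)
  have "continuous_on X (T ^^ j) \<and> (T ^^ j) ` X \<subseteq> X"
  proof (induction j)
    case (Suc j)
    then have "continuous_on X (\<lambda>x. T ((T ^^ j) x))"
      using continuous_on_compose2[OF T(1)] by blast
    then show ?case using Suc T by (auto simp: o_def)
  qed (simp add: continuous_on_id)
  moreover have "openin (top_of_set X) (B k)"
    using assms(1) k by (auto simp: clopen_kr_partition_def)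
  ultimately show ?thesis
    unfolding P kr_atom_def by (intro continuous_openin_preimage[where T = X]) (auto simp: image_subset_iff_funcset)
qed

text \<open>
  A word of length at most every height starts in some atom \<open>(k, j)\<close> and leaves the \<open>k\<close>-th tower
  at most once, for a tower \<open>k'\<close> out of which it does not run: \<open>(k, j, k')\<close> determines it.
\<close>
lemma complexity_itinerary_kr_le:
  assumes kr: "clopen_kr_partition X T d B h" and T: "bij_betw T X X"
    and n: "\<And>k. k \<in> {1..d} \<Longrightarrow> n \<le> h k"
    and c: "\<And>P x y. P \<in> kr_atoms X T d B h \<Longrightarrow> x \<in> P \<Longrightarrow> y \<in> P \<Longrightarrow> c x = c y"
  shows "complexity (itinerary X T c ` X) n \<le> (\<Sum>k\<in>{1..d}. h k) * d"
proof -
  \<comment> \<open>The letter of the atom \<open>(k, j)\<close>, read off at an arbitrary point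
    because \<open>c\<close> is constant there.\<close>
  define g where "g k j = c (SOME x. x \<in> kr_atom X T B k j)" for k j
  have g: "c x = g k j" if "x \<in> kr_atom X T B k j" "k \<in> {1..d}" "j < h k" for x k j
    unfolding g_def using c[OF kr_atom_in_atoms] that by (meson someI)
  \<comment> \<open>Levels decrease by one along an orbit: from level \<open>j\<close> of tower
    \<open>k\<close> the base is reached at time \<open>j\<close>; at a time \<open>i > j\<close>
    the level in tower \<open>k'\<close> is \<open>h k' - (i - j)\<close>.\<close>
  define W where "W = (\<lambda>((k, j), k').
    map (\<lambda>i. if i \<le> j then g k (j - i) else g k' (h k' - (i - j))) [0..<n])"
  have iter: "(T ^^ i) z \<in> X" if "z \<in> X" for i z
    using that T by (induction i) (auto simp: bij_betw_apply)
  have "(\<lambda>z. map (\<lambda>i. c ((T ^^ i) z)) [0..<n]) ` X \<subseteq> W ` (kr_indices d h \<times> {1..d})"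
  proof (clarify)
    fix z assume z: "z \<in> X"
    then obtain k j where k: "k \<in> {1..d}" "j < h k" and zk: "(T ^^ j) z \<in> B k"
      using kr_partitionD(1)[OF kr] by (fastforce simp: kr_atoms_def kr_indices_def kr_atom_def)
    then have "(T ^^ j) z \<in> kr_base d B" by (auto simp: kr_base_def)
    \<comment> \<open>The return condition on the bases selects the next tower \<open>k'\<close>:
      the point after the base is at its top level, \<open>h k' - 1\<close>.\<close>
    then have "(T ^^ j) z \<in> (\<Union>k\<in>{1..d}. kr_atom X T B k (h k))"
      using kr unfolding clopen_kr_partition_def by metis
    then obtain k' where k': "k' \<in> {1..d}" and zk': "(T ^^ h k') ((T ^^ j) z) \<in> B k'"
      by (auto simp: kr_atom_def)
    have "c ((T ^^ i) z) = (if i \<le> j then g k (j - i) else g k' (h k' - (i - j)))" if "i < n" for i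
    proof (cases "i \<le> j")
      case True
      then have "(T ^^ i) z \<in> kr_atom X T B k (j - i)"
        using iter[OF z] zk by (simp add: kr_atom_def flip: funpow_add[unfolded o_def, THEN fun_cong])
      with True k show ?thesis by (auto intro!: g)
    next
      case False
      \<comment> \<open>The subtraction does not truncate, since \<open>i - j < n\<close> and
        \<open>n\<close> is at most \<open>h k'\<close>: the word ends inside tower
        \<open>k'\<close>.\<close>
      then have "h k' - (i - j) + i = h k' + j"
        using n[OF k'] \<open>i < n\<close> by simp
      then have "(T ^^ i) z \<in> kr_atom X T B k' (h k' - (i - j))"
        using iter[OF z] zk' by (metis (mono_tags) IntI funpow_add kr_atom_def o_apply vimageI)
      with False k' n[OF k'] \<open>i < n\<close> show ?thesis by (auto intro!: g)
    qed
    then have "map (\<lambda>i. c ((T ^^ i) z)) [0..<n] = W ((k, j), k')"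
      by (simp add: W_def)
    then show "map (\<lambda>i. c ((T ^^ i) z)) [0..<n] \<in> W ` (kr_indices d h \<times> {1..d})"
      using k k' by (auto simp: kr_indices_def)
  qed
  then have "words_of_length (itinerary X T c ` X) n \<subseteq> W ` (kr_indices d h \<times> {1..d})"
    using words_of_length_itinerary[OF T] by (rule order_trans[rotated])
  then have "complexity (itinerary X T c ` X) n \<le> card (kr_indices d h \<times> {1..d})"
    unfolding complexity_def by (rule surj_card_le[rotated]) (simp add: finite_kr_indices)
  also have "\<dots> = (\<Sum>k\<in>{1..d}. h k) * d"
    by (simp add: card_cartesian_product kr_indices_def card_SigmaI)
  finally show ?thesis .
qed

section \<open>Nested sequences: small atoms and growing heights\<close>

lemma nested_kr_partitions_refine:
  assumes "nested_kr_partitions X T d B h" and "m \<le> n" and "P \<in> kr_atoms X T (d n) (B n) (h n)"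
  shows "\<exists>Q\<in>kr_atoms X T (d m) (B m) (h m). P \<subseteq> Q"
  using assms(2,3)
proof (induction n arbitrary: P rule: dec_induct)
  case (step n)
  then show ?case
    using assms(1) unfolding nested_kr_partitions_def by (meson order_trans)
qed auto

text \<open>The atoms are given only as a subbasis; since the partitions refine one another, they
  form a basis.\<close>

lemma nested_kr_partitions_atom_subset_open:
  assumes nest: "nested_kr_partitions X T d B h"
    and U: "openin (top_of_set X) U" and x: "x \<in> U"
  shows "\<exists>m. \<exists>P\<in>kr_atoms X T (d m) (B m) (h m). x \<in> P \<and> P \<subseteq> U"
proof -
  let ?A = "\<lambda>n. kr_atoms X T (d n) (B n) (h n)"
  have kr: "clopen_kr_partition X T (d n) (B n) (h n)" for n
    using nest by (simp add: nested_kr_partitions_def)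
  have xX: "x \<in> X"
    using openin_subset[OF U] x by auto
  have "generate_topology_on (\<Union>n. ?A n) U"
    using U nest by (simp add: nested_kr_partitions_def openin_topology_generated_by_iff)
  \<comment> \<open>Strengthened to all levels from \<open>m\<close> on, so that finite
    intersections are handled by a maximum.\<close>
  then have "x \<in> U \<Longrightarrow> \<exists>m. \<forall>n\<ge>m. \<forall>P\<in>?A n. x \<in> P \<longrightarrow> P \<subseteq> U"
  proof (induction rule: generate_topology_on.induct)
    case (Int a b)
    then obtain m m' where "\<forall>n\<ge>m. \<forall>P\<in>?A n. x \<in> P \<longrightarrow> P \<subseteq> a" "\<forall>n\<ge>m'. \<forall>P\<in>?A n. x \<in> P \<longrightarrow> P \<subseteq> b"
      by auto
    then have "\<forall>n\<ge>max m m'. \<forall>P\<in>?A n. x \<in> P \<longrightarrow> P \<subseteq> a \<inter> b"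
      by (simp add: le_inf_iff) blast
    then show ?case by blast
  next
    case (UN K)
    then obtain a where a: "a \<in> K" "x \<in> a" by blast
    then obtain m where "\<forall>n\<ge>m. \<forall>P\<in>?A n. x \<in> P \<longrightarrow> P \<subseteq> a"
      using UN.IH by blast
    then have "\<forall>n\<ge>m. \<forall>P\<in>?A n. x \<in> P \<longrightarrow> P \<subseteq> \<Union>K"
      using a(1) by blast
    then show ?case by blast
  next
    case (Basis s)
    then obtain m where m: "s \<in> ?A m" by blast
    have "P \<subseteq> s" if P: "n \<ge> m" "P \<in> ?A n" "x \<in> P" for n P
    proof -
      obtain Q where "Q \<in> ?A m" "P \<subseteq> Q"
        using nested_kr_partitions_refine[OF nest P(1,2)] by blast
      then show ?thesis
        using kr_partitionD(2)[OF kr _ m] P(3) Basis(2) by blast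
    qed
    then show ?case by blast
  qed simp
  then obtain m where "\<forall>n\<ge>m. \<forall>P\<in>?A n. x \<in> P \<longrightarrow> P \<subseteq> U"
    using x by blast
  then have "\<forall>P\<in>?A m. x \<in> P \<longrightarrow> P \<subseteq> U"
    using order_refl by blast
  moreover obtain P where "P \<in> ?A m" "x \<in> P"
    using kr_partitionD(1)[OF kr, of m] xX by auto
  ultimately show ?thesis by blast
qed

text \<open>Every point has a small open atom at some level. Finitely many of these cover
  \<open>X\<close>, and the atoms of the largest level involved refine this cover.\<close>

lemma nested_kr_partitions_small_atoms:
  fixes X :: "'a::metric_space set"
  assumes nest: "nested_kr_partitions X T d B h" and X: "compact X" and \<delta>: "0 < \<delta>"
    and T: "continuous_on X T" "T ` X \<subseteq> X"
  shows "\<exists>m. \<forall>P\<in>kr_atoms X T (d m) (B m) (h m). \<forall>x\<in>P. \<forall>y\<in>P. dist x y \<le> \<delta>"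
proof -
  let ?A = "\<lambda>n. kr_atoms X T (d n) (B n) (h n)"
  have kr: "clopen_kr_partition X T (d n) (B n) (h n)" for n
    using nest by (simp add: nested_kr_partitions_def)
  have "\<exists>m. \<exists>P\<in>?A m. x \<in> P \<and> P \<subseteq> X \<inter> ball x (\<delta> / 2)" if "x \<in> X" for x
    using that \<delta> by (intro nested_kr_partitions_atom_subset_open[OF nest]) auto
  then obtain m P where P: "\<And>x. x \<in> X \<Longrightarrow> P x \<in> ?A (m x) \<and> x \<in> P x \<and> P x \<subseteq> X \<inter> ball x (\<delta> / 2)"
    by metis
  have "\<forall>x\<in>X. \<exists>V. open V \<and> P x = X \<inter> V"
    using openin_kr_atom[OF kr T] P by (metis openin_open)
  then obtain V where V: "\<And>x. x \<in> X \<Longrightarrow> open (V x) \<and> P x = X \<inter> V x"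
    by metis
  obtain F where F: "F \<subseteq> X" "finite F" "X \<subseteq> (\<Union>x\<in>F. V x)"
  proof (rule compactE_image[OF X, of X V])
    show "X \<subseteq> (\<Union>x\<in>X. V x)"
      using V P by blast
  qed (use V in auto)
  define M where "M = Max (insert 0 (m ` F))"
  have "dist y z \<le> \<delta>" if Q: "Q \<in> ?A M" "y \<in> Q" "z \<in> Q" for Q y z
  proof -
    have "y \<in> X" using kr_partitionD(1)[OF kr] Q by blast
    then obtain x where x: "x \<in> F" "y \<in> P x"
      using F V by blast
    then have "m x \<le> M" using F(2) by (simp add: M_def)
    then obtain Q' where "Q' \<in> ?A (m x)" "Q \<subseteq> Q'"
      using nested_kr_partitions_refine[OF nest _ Q(1)] by blast
    then have "Q \<subseteq> P x"
      using kr_partitionD(2)[OF kr, of Q' "m x" "P x" y] P x Q F(1) by blast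
    then have "dist x y < \<delta> / 2" "dist x z < \<delta> / 2"
      using P[of x] x F(1) Q(2,3) by (auto simp: subset_iff)
    then show ?thesis
      using dist_triangle3[of y z x] by simp
  qed
  then show ?thesis by blast
qed

text \<open>A tower of height \<open>j\<close> has a point of the base sent by \<open>T ^^ j\<close>
  into the base. If such points existed at all levels, compactness would give one for which both it
  and its image lie in every base, hence coincide, against aperiodicity.\<close>

lemma nested_kr_partitions_heights_unbounded:
  fixes X :: "'a::metric_space set"
  assumes nest: "nested_kr_partitions X T d B h" and X: "compact X"
    and T: "continuous_on X T" "T ` X = X"
    and aper: "\<And>x j. x \<in> X \<Longrightarrow> 0 < j \<Longrightarrow> (T ^^ j) x \<noteq> x"
  shows "\<exists>M. \<forall>n\<ge>M. \<forall>k\<in>{1..d n}. m < h n k"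
proof -
  define b where "b n = kr_base (d n) (B n)" for n
  define G where "G j n = b n \<inter> (X \<inter> (T ^^ j) -` b n)" for j n
  have kr: "clopen_kr_partition X T (d n) (B n) (h n)" for n
    using nest by (simp add: nested_kr_partitions_def)
  have iter: "continuous_on X (T ^^ j) \<and> (T ^^ j) ` X = X" for j
  proof (induction j)
    case (Suc j)
    then have "continuous_on X (\<lambda>x. T ((T ^^ j) x))"
      using continuous_on_compose2[OF T(1)] by blast
    moreover have "(T ^^ Suc j) ` X = T ` (T ^^ j) ` X"
      by (simp add: image_comp)
    ultimately show ?case using Suc T by (simp add: o_def)
  qed (simp add: continuous_on_id)
  have b_closed: "closedin (top_of_set X) (b n)" for n
    unfolding b_def kr_base_def
    using kr[of n] by (intro closedin_Union) (auto simp: clopen_kr_partition_def)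
  have b_anti: "b n \<subseteq> b m" if "m \<le> n" for m n
    using lift_Suc_antimono_le[of b, OF _ that] nest
    by (simp add: nested_kr_partitions_def b_def)
  have G_anti: "G j n \<subseteq> G j m" if "m \<le> n" for j m n
    using b_anti[OF that] by (auto simp: G_def)
  have "\<exists>N. G j N = {}" if j: "0 < j" for j
  proof (rule ccontr)
    assume "\<not> ?thesis"
    moreover have "closedin (top_of_set X) (G j n)" for n
      unfolding G_def
      by (intro closedin_Int b_closed continuous_closedin_preimage_gen[where T = X])
         (use iter b_closed in auto)
    ultimately have "(\<Inter>n. G j n) \<noteq> {}"
      using X G_anti
      by (intro compact_space_imp_nest[of "top_of_set X"]) (auto simp: compact_space_subtopology decseq_def)
    then obtain x where x: "\<And>n. x \<in> b n" "\<And>n. (T ^^ j) x \<in> b n" "x \<in> X"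
      by (auto simp: G_def)
    moreover obtain z where "(\<Inter>n. b n) = {z}"
      using nest by (auto simp: nested_kr_partitions_def b_def)
    ultimately have "x = z" "(T ^^ j) x = z" by blast+
    then show False using aper[OF x(3) j] by simp
  qed
  then obtain N where N: "\<And>j. 0 < j \<Longrightarrow> G j (N j) = {}" by metis
  \<comment> \<open>From level \<open>M\<close> on, no \<open>j\<close> with \<open>0 < j\<close>
    and \<open>j \<le> m\<close> is a return time; the inserted 0 covers
    \<open>m = 0\<close>.\<close>
  define M where "M = Max (insert 0 (N ` {1..m}))"
  have "m < h n k" if n: "n \<ge> M" and k: "k \<in> {1..d n}" for n k
  proof (rule ccontr)
    assume "\<not> m < h n k"
    moreover have h1: "1 \<le> h n k"
      using kr[of n] k by (auto simp: clopen_kr_partition_def)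
    ultimately have "N (h n k) \<le> M"
      by (auto simp: M_def)
    then have empty: "G (h n k) n = {}"
      using G_anti[of "N (h n k)" n "h n k"] n h1 N[of "h n k"] by simp
    have "kr_atom X T (B n) k 0 \<in> kr_atoms X T (d n) (B n) (h n)"
      using kr_atom_in_atoms[OF k, of 0 "h n"] h1 by simp
    then have "kr_atom X T (B n) k 0 \<noteq> {}"
      using kr_partitionD(3)[OF kr] by metis
    then obtain z where "z \<in> X" "z \<in> B n k"
      by (auto simp: kr_atom_def)
    \<comment> \<open>Going back \<open>h n k\<close> steps from the base of tower \<open>k\<close>
      ends in the base again, by the return condition. So \<open>y\<close> contradicts the emptiness
      of \<open>G (h n k) n\<close>.\<close>
    moreover obtain y where y: "y \<in> X" "(T ^^ h n k) y = z"
      using iter[of "h n k"] \<open>z \<in> X\<close> by (metis imageE)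
    ultimately have "y \<in> kr_atom X T (B n) k (h n k)" "z \<in> b n"
      using k by (auto simp: kr_atom_def b_def kr_base_def)
    moreover have "(\<Union>k\<in>{1..d n}. kr_atom X T (B n) k (h n k)) = b n"
      using kr[of n] unfolding clopen_kr_partition_def b_def by metis
    ultimately have "y \<in> G (h n k) n"
      using k y by (auto simp: G_def)
    with empty show False by simp
  qed
  then show ?thesis by blast
qed

section \<open>Lower limits and the linear complexity bound\<close>

lemma liminf_finite_imp_frequently_less:
  fixes u :: "nat \<Rightarrow> ereal"
  assumes "liminf u < \<infinity>"
  shows "\<exists>C::real. \<forall>M. \<exists>n\<ge>M. u n < ereal C"
proof -
  obtain C :: real where C: "liminf u < ereal C"
    using assms less_PInf_Ex_of_nat by auto
  then have "\<not> (\<forall>\<^sub>F n in sequentially. ereal C \<le> u n)"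
    using Liminf_bounded[of "ereal C" u sequentially] by auto
  then show ?thesis
    by (auto simp: eventually_sequentially not_le)
qed

lemma non_superlinear_complexityI:
  assumes "\<And>m. \<exists>n>m. real (complexity Y n) \<le> K * real n"
  shows "non_superlinear_complexity Y"
  unfolding non_superlinear_complexity_def
proof (rule ccontr)
  assume "\<not> liminf (\<lambda>n. ereal (real (complexity Y n) / real n)) < \<infinity>"
  then have "ereal K < liminf (\<lambda>n. ereal (real (complexity Y n) / real n))"
    by auto
  then obtain m where m: "\<And>n. n \<ge> m \<Longrightarrow> K < real (complexity Y n) / real n"
    using less_LiminfD[of "ereal K"] by (fastforce simp: eventually_sequentially)
  \<comment> \<open>The strict inequality makes \<open>n\<close> positive, so the quotient can be
    cleared.\<close>
  obtain n where n: "n > m" "real (complexity Y n) \<le> K * real n"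
    using assms by blast
  then show False
    using m[of n] by (simp add: field_simps)
qed

text \<open>At a level with height ratios below \<open>C\<close>, words as long as the smallest
  height number at most \<open>d n\<close> times the sum of the heights, a sum of \<open>d n\<close>
  terms each at most \<open>C\<close> times that length.\<close>

lemma nested_kr_partitions_complexity:
  fixes X :: "'a::metric_space set"
  assumes nest: "nested_kr_partitions X T d B h" and X: "compact X" "X \<noteq> {}"
    and T: "continuous_on X T" "bij_betw T X X"
    and aper: "\<And>x j. x \<in> X \<Longrightarrow> 0 < j \<Longrightarrow> (T ^^ j) x \<noteq> x"
    and d: "\<And>n. d n \<le> D"
    and ratio: "liminf (\<lambda>n. SUP (k, k')\<in>{1..d n} \<times> {1..d n}.
           ereal (real (h n k) / real (h n k'))) < \<infinity>"
    and c: "\<And>P x y. P \<in> kr_atoms X T (d m) (B m) (h m) \<Longrightarrow> x \<in> P \<Longrightarrow> y \<in> P \<Longrightarrow> c x = c y"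
  shows "non_superlinear_complexity (itinerary X T c ` X)"
proof -
  have TX: "T ` X = X"
    using T(2) by (simp add: bij_betw_def)
  have kr: "clopen_kr_partition X T (d n) (B n) (h n)" for n
    using nest by (simp add: nested_kr_partitions_def)
  obtain C :: real where C: "\<And>M. \<exists>n\<ge>M. (SUP (k, k')\<in>{1..d n} \<times> {1..d n}.
           ereal (real (h n k) / real (h n k'))) < ereal C"
    using liminf_finite_imp_frequently_less[OF ratio] by metis
  show ?thesis
  \<comment> \<open>One factor \<open>D\<close> bounds the number of heights summed, the other the
    choices of the second tower.\<close>
  proof (rule non_superlinear_complexityI[where K = "real D * real D * C"])
    fix l
    obtain M where M: "\<forall>n\<ge>M. \<forall>k\<in>{1..d n}. l < h n k"
      using nested_kr_partitions_heights_unbounded[OF nest X(1) T(1) TX aper] by blast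
    obtain n where n: "n \<ge> max M m" and sup: "(SUP (k, k')\<in>{1..d n} \<times> {1..d n}.
           ereal (real (h n k) / real (h n k'))) < ereal C"
      using C by metis
    have "{1..d n} \<noteq> {}"
      using kr_partitionD(1)[OF kr, of n] X(2) by (auto simp: kr_atoms_def kr_indices_def)
    then obtain k1 where "k1 \<in> {1..d n}" by blast
    from ex_has_least_nat[of "\<lambda>k. k \<in> {1..d n}", OF this, of "h n"]
    obtain k0 where k0: "k0 \<in> {1..d n}" and min: "\<And>k. k \<in> {1..d n} \<Longrightarrow> h n k0 \<le> h n k"
      by blast
    have pos: "l < h n k0" using M n k0 by simp
    have le: "real (h n k) \<le> C * real (h n k0)" if "k \<in> {1..d n}" for k
    proof -
      have "ereal (real (h n k) / real (h n k0)) \<le> (SUP (k, k')\<in>{1..d n} \<times> {1..d n}.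
           ereal (real (h n k) / real (h n k')))"
        using that k0 by (intro SUP_upper2[of "(k, k0)"]) auto
      then have "ereal (real (h n k) / real (h n k0)) < ereal C"
        using sup by (rule le_less_trans)
      then have "real (h n k) / real (h n k0) < C" by simp
      then show ?thesis using pos by (simp add: field_simps)
    qed
    \<comment> \<open>The sign of \<open>C\<close> is not known beforehand; it matters when
      \<open>d n\<close> is replaced by \<open>D\<close>.\<close>
    have "0 \<le> C * real (h n k0)" using le[OF k0] by simp
    \<comment> \<open>The code is defined by level \<open>m\<close>; it stays constant on the finer
      atoms of level \<open>n\<close>.\<close>
    have c': "c x = c y" if P: "P \<in> kr_atoms X T (d n) (B n) (h n)" "x \<in> P" "y \<in> P" for P x y
    proof -
      obtain Q where "Q \<in> kr_atoms X T (d m) (B m) (h m)" "P \<subseteq> Q"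
        using nested_kr_partitions_refine[OF nest _ P(1), of m] n by auto
      then show ?thesis using c P by blast
    qed
    have "complexity (itinerary X T c ` X) (h n k0) \<le> (\<Sum>k\<in>{1..d n}. h n k) * d n"
      using complexity_itinerary_kr_le[OF kr T(2) min c'] .
    then have "real (complexity (itinerary X T c ` X) (h n k0)) \<le> (\<Sum>k\<in>{1..d n}. real (h n k)) * real (d n)"
      by (simp flip: of_nat_sum of_nat_mult)
    also have "\<dots> \<le> (\<Sum>k\<in>{1..d n}. C * real (h n k0)) * real (d n)"
      using le by (intro mult_right_mono sum_mono) auto
    also have "\<dots> = real (d n) * real (d n) * (C * real (h n k0))"
      by simp
    also have "\<dots> \<le> real D * real D * (C * real (h n k0))"
      using d[of n] \<open>0 \<le> C * real (h n k0)\<close> by (intro mult_right_mono mult_mono) auto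
    finally show "\<exists>n>l. real (complexity (itinerary X T c ` X) n) \<le> real D * real D * C * real n"
      using pos by (auto simp: mult.assoc)
  qed
qed

section \<open>Letters for the atoms of a finite partition\<close>

text \<open>Numbering the atoms injectively is continuous because the preimage of any set of numbers
  is a union of open atoms.\<close>

lemma clopen_partition_coding:
  fixes X :: "'a::topological_space set"
  assumes A: "finite A" "partition_on X A" "\<And>P. P \<in> A \<Longrightarrow> openin (top_of_set X) P"
  shows "\<exists>c :: 'a \<Rightarrow> nat. continuous_on X c \<and> finite (c ` X) \<and>
    (\<forall>P\<in>A. \<forall>x\<in>P. \<forall>y\<in>P. c x = c y) \<and>
    (\<forall>x\<in>X. \<forall>y\<in>X. c x = c y \<longrightarrow> (\<exists>P\<in>A. x \<in> P \<and> y \<in> P))"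
proof -
  obtain e :: "'a set \<Rightarrow> nat" where e: "inj_on e A"
    using finite_imp_inj_to_nat_seg[OF A(1)] by metis
  define c where "c x = e (THE P. P \<in> A \<and> x \<in> P)" for x
  have c: "c x = e P" if "P \<in> A" "x \<in> P" for x P
  proof -
    have "(THE P. P \<in> A \<and> x \<in> P) = P"
      using that disjointD[OF partition_onD2[OF A(2)]] by (intro the_equality) blast+
    then show ?thesis by (simp add: c_def)
  qed
  have cover: "\<exists>P\<in>A. x \<in> P" if "x \<in> X" for x
    using partition_onD1[OF A(2)] that by blast
  show ?thesis
  proof (intro exI[of _ c] conjI ballI impI)
    have "openin (top_of_set X) (X \<inter> c -` V)" for V
    proof -
      have "X \<inter> c -` V = \<Union>{P \<in> A. e P \<in> V}"
        using cover c partition_onD1[OF A(2)] by fastforce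
      then show ?thesis using A(3) by (metis (no_types, lifting) mem_Collect_eq openin_Union)
    qed
    then show "continuous_on X c"
      by (simp add: continuous_on_open_gen[of c X UNIV] continuous_openin_preimage_eq)
    have "c ` X \<subseteq> e ` A"
      using cover c by fastforce
    then show "finite (c ` X)"
      using A(1) finite_surj by blast
    show "c x = c y" if "P \<in> A" "x \<in> P" "y \<in> P" for P x y
      using c that by simp
    show "\<exists>P\<in>A. x \<in> P \<and> y \<in> P" if xy: "x \<in> X" "y \<in> X" "c x = c y" for x y
    proof -
      obtain P Q where "P \<in> A" "x \<in> P" "Q \<in> A" "y \<in> Q"
        using cover xy by meson
      then show ?thesis
        using c[of P x] c[of Q y] xy(3) inj_onD[OF e, of P Q] by auto
    qed
  qed
qed

section \<open>The conjugate subshift\<close>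

theorem corollary6p8:
  fixes X :: "'a::metric_space set"
    and T :: "'a \<Rightarrow> 'a"
    and d :: "nat \<Rightarrow> nat"
    and B :: "nat \<Rightarrow> nat \<Rightarrow> 'a set"
    and h :: "nat \<Rightarrow> nat \<Rightarrow> nat"
  assumes "minimal_cantor_system X T"
    and "expansive X T"
    and "nested_kr_partitions X T d B h"
    and "(SUP n. enat (d n)) < \<infinity>"
    and "liminf (\<lambda>n. SUP (k, k')\<in>{1..d n} \<times> {1..d n}.
           ereal (real (h n k) / real (h n k'))) < \<infinity>"
  shows "\<exists>Y :: (int \<Rightarrow> nat) set.
           minimal_subshift Y \<and>
           topologically_conjugate X T Y shift_map \<and>
           non_superlinear_complexity Y"
proof -
  note nest = assms(3)
  obtain T' where hom: "homeomorphism X X T T'" and cantor: "is_cantor_set X"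
    and dense: "all_orbits_dense X T"
    using assms(1) by (auto simp: minimal_cantor_system_def)
  note bij = homeomorphism_bij_betw[OF hom]
  have X: "compact X" "infinite X"
    using cantor is_cantor_set_compact is_cantor_set_infinite by auto
  then have X_ne: "X \<noteq> {}" by auto
  have T: "continuous_on X T" "T ` X \<subseteq> X"
    using hom by (auto simp: homeomorphism_def)
  obtain \<delta> where \<delta>: "\<delta> > 0" and exp: "\<And>x y. x \<in> X \<Longrightarrow> y \<in> X \<Longrightarrow> x \<noteq> y \<Longrightarrow>
      \<exists>n. dist (int_iterate X T n x) (int_iterate X T n y) > \<delta>"
    using assms(2) by (auto simp: expansive_def)
  \<comment> \<open>At this level, points with the same letter are within \<delta>, while
    expansivity moves distinct points more than \<delta> apart at some time: itineraries separate
    points.\<close>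
  obtain m where small: "\<And>P x y. P \<in> kr_atoms X T (d m) (B m) (h m) \<Longrightarrow> x \<in> P \<Longrightarrow> y \<in> P \<Longrightarrow> dist x y \<le> \<delta>"
    using nested_kr_partitions_small_atoms[OF nest X(1) \<delta> T] by metis
  have kr: "clopen_kr_partition X T (d m) (B m) (h m)"
    using nest by (simp add: nested_kr_partitions_def)
  then have part: "partition_on X (kr_atoms X T (d m) (B m) (h m))"
    by (simp add: clopen_kr_partition_def)
  obtain c :: "'a \<Rightarrow> nat" where c: "continuous_on X c" "finite (c ` X)"
    and c_const: "\<forall>P\<in>kr_atoms X T (d m) (B m) (h m). \<forall>x\<in>P. \<forall>y\<in>P. c x = c y"
    and c_sep: "\<forall>x\<in>X. \<forall>y\<in>X. c x = c y \<longrightarrow>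
      (\<exists>P\<in>kr_atoms X T (d m) (B m) (h m). x \<in> P \<and> y \<in> P)"
    using clopen_partition_coding[OF finite_kr_atoms part openin_kr_atom[OF kr T], simplified]
    by (elim exE conjE) (rule that)
  have sep: "\<exists>i. c (int_iterate X T i x) \<noteq> c (int_iterate X T i y)"
    if xy: "x \<in> X" "y \<in> X" "x \<noteq> y" for x y
  proof -
    obtain i where i: "dist (int_iterate X T i x) (int_iterate X T i y) > \<delta>"
      using exp[OF xy] by blast
    have "c (int_iterate X T i x) \<noteq> c (int_iterate X T i y)"
    proof
      assume "c (int_iterate X T i x) = c (int_iterate X T i y)"
      then obtain P where "P \<in> kr_atoms X T (d m) (B m) (h m)"
        "int_iterate X T i x \<in> P" "int_iterate X T i y \<in> P"
        using c_sep int_iterate_in[OF bij] xy(1,2) by blast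
      with small i show False by fastforce
    qed
    then show ?thesis by blast
  qed
  obtain D where SUP_D: "(SUP n. enat (d n)) = enat D"
    using assms(4) by auto
  have D: "d n \<le> D" for n
    using SUP_upper[of n UNIV "\<lambda>n. enat (d n)"] by (simp add: SUP_D)
  have "non_superlinear_complexity (itinerary X T c ` X)"
    using nested_kr_partitions_complexity[OF nest X(1) X_ne T(1) bij
        minimal_aperiodic[OF bij dense X(2)] D assms(5) c_const[rule_format]] .
  then show ?thesis
    using itinerary_conjugacy[OF X(1) X_ne hom dense c sep] by blast
qed

end
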